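(* Consider the fully composite problem $\varphi^*=\min_{x\in\operatorname{dom}\varphi}\{\varphi(x)=F(x,f(x))\}$ with subhomogeneous outer function (see context). For the iterations of the Fully Composite Contracting Proximal-Point Scheme described in the context, for all $k\ge0$ we have $$A_k\varphi(x_k)+\rho_d(v_k;x)\ \le\ A_k\varphi(x)+\rho_d(x_0;x)+C_k(x),\qquad x\in\mathbb{E},$$ where $$C_k(x)=k\delta+c_1(x)\sum_{i=1}^k\|x-v_i\|+c_2\sum_{i=1}^k\|x-v_i\|^2,$$ with $$c_1(x)=\alpha^{1/3}(6\delta)^{2/3}+2\alpha^{2/3}(6\delta)^{1/3}\|x-x_0\|,\qquad c_2=2\alpha^{2/3}(6\delta)^{1/3}.$$
   Context: $\mathbb{E}$ is a finite-dimensional real vector space with norm $\|x\|=\langle Bx,x\rangle^{1/2}$, where $B:\mathbb{E}\to\mathbb{E}^*$ is self-adjoint positive definite. Fully composite problem: $F:\mathbb{E}\times\mathbb{R}^m\to\mathbb{R}\cup\{+\infty\}$ is closed and convex on its domain, and for any $x\in\mathbb{E}$ for which $\mathcal{D}(x)=\{u\in\mathbb{R}^m:F(x,u)<+\infty\}$ is nonempty, $F(x,\cdot)$ is closed, convex and monotone on $\mathcal{D}(x)$ ($u\le v$ componentwise implies $F(x,u)\le F(x,v)$). $f=(f_1,\dots,f_m)^T:\operatorname{dom} f\to\mathbb{R}^m$, $\operatorname{dom} f\subseteq\mathbb{E}$ open and convex; all $f_i$ are closed, convex and twice continuously differentiable with Lipschitz continuous Hessian. $\varphi(x)=F(x,f(x))$,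 $\operatorname{dom}\varphi=\{x\in\operatorname{dom} f:F(x,f(x))<+\infty\}$, $\varphi=+\infty$ outside $\operatorname{dom}\varphi$; a solution $x^*$ with $\varphi(x^* )=\varphi^*$ is assumed to exist. Subhomogeneity: for any $x\in\operatorname{dom}\varphi$, $F(x,u)$ is subhomogeneous in $u\in\mathbb{R}^m$, so that $F(x,u+tv)\le F(x,u)+tF(x,v)$ for all $u,v\in\mathbb{R}^m$, $t\ge0$. $L_2(f_i)$ is a Lipschitz constant of $\nabla^2f_i$ (operator norm w.r.t. $\|\cdot\|$); $L_2(f)=(L_2(f_1),\dots,L_2(f_m))^T$; $F(L_2(f))=\sup_{x\in\operatorname{dom}\varphi}F(x,L_2(f))$. $\Omega_2(g,x;y)=g(x)+\langle\nabla g(x),y-x\rangle+\frac12\langle\nabla^2g(x)(y-x),y-x\rangle$ (componentwise). Prox-function: $d(x)=\frac\alpha3\|x-x_0\|^3$ with $\alpha=F(L_2(f))$, and Bregman divergence $\rho_d(x;y)=d(y)-d(x)-\langle\nabla d(x),y-x\rangle$. Scheme: choose $x_0\in\operatorname{dom}\varphi$ and $\delta>0$; set $v_0=x_0$, $A_0=0$. For $k\ge0$: (1) $A_{k+1}=\big(\frac{k+1}3\big)^3$, $\gamma_k=\frac{A_{k+1}-A_k}{A_{k+1}}$; (2) form $h_{k+1}(x)=A_{k+1}\varphi(\gamma_kx+(1-\gamma_k)x_k)+\rho_d(v_k;x)$; (3) find a point $v_{k+1}$ such that $h_{k+1}(v_{k+1})-h_{k+1}^*\le\delta$, where $h_{k+1}^*$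 is the minimal value of $h_{k+1}$, by the basic Fully Composite Cubic Newton Method; (4) $x_{k+1}=\gamma_kv_{k+1}+(1-\gamma_k)x_k$. Cubic Newton Method on the subproblem: write $h_{k+1}(x)=\bar F(x,\bar f(x))$ with $\bar f(x)=f(\gamma_kx+(1-\gamma_k)x_k)$ and $\bar F(x,u)=A_{k+1}F(\gamma_kx+(1-\gamma_k)x_k,u)+\rho_d(v_k;x)$; the method iterates $z_{t+1}=\operatorname{argmin}_{x\in\operatorname{dom}\varphi}\{\bar F(x,\Omega_2(\bar f,z_t;x))+\frac M6\|x-z_t\|^3\}$, where $M=a\,\bar F(L_2(\bar f))$ with $a\ge1$ and $\bar F(L_2(\bar f))$ is defined for $\bar F,\bar f$ as $F(L_2(f))$ is for $F,f$. *)

theory Defs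
  imports "HOL-Analysis.Analysis"
begin

section \<open>The norm induced by $B$\<close>

text \<open>
  The operator $B$ from the space to its dual is the two-argument function with
  $B\,p\,q = \langle Bp, q\rangle$. The inner product of the type class is not used: it only
  supplies the topology, which is the same for all norms in finite dimension.
\<close>

definition self_adjoint_pos_def :: "('a::euclidean_space \<Rightarrow> 'a \<Rightarrow> real) \<Rightarrow> bool" where
  "self_adjoint_pos_def B \<longleftrightarrow>
     bilinear B \<and> (\<forall>p q. B p q = B q p) \<and> (\<forall>p. p \<noteq> 0 \<longrightarrow> B p p > 0)"

definition bnorm :: "('a::euclidean_space \<Rightarrow> 'a \<Rightarrow> real) \<Rightarrow> 'a \<Rightarrow> real" where
  "bnorm B p = sqrt (B p p)"

section \<open>Closed convex functions\<close>

text \<open>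
  A function is closed and convex on \<open>S\<close> if its epigraph over \<open>S\<close> is a closed convex set; in
  particular an open \<open>S\<close> other than the whole space forces the values to blow up at its boundary.
\<close>

definition epigraph_on :: "'b set \<Rightarrow> ('b \<Rightarrow> ereal) \<Rightarrow> ('b \<times> real) set" where
  "epigraph_on S g = {(p, t). p \<in> S \<and> g p \<le> ereal t}"

definition closed_convex_on :: "'b::real_normed_vector set \<Rightarrow> ('b \<Rightarrow> ereal) \<Rightarrow> bool" where
  "closed_convex_on S g \<longleftrightarrow> closed (epigraph_on S g) \<and> convex (epigraph_on S g)"

section \<open>Second derivatives\<close>

text \<open>\<open>frechet_derivative g (at p) q\<close> is $\langle\nabla g(p), q\rangle$ and
  \<open>hess g p u w\<close> is $\langle\nabla^2 g(p)u, w\rangle$.\<close>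

definition hess :: "('a::euclidean_space \<Rightarrow> real) \<Rightarrow> 'a \<Rightarrow> 'a \<Rightarrow> 'a \<Rightarrow> real" where
  "hess g p u w = frechet_derivative (\<lambda>q. frechet_derivative g (at q) w) (at p) u"

text \<open>Since the space is finite-dimensional, differentiability of the gradient and continuity of the
  Hessian may be tested on fixed arguments.\<close>

definition C2_on :: "'a::euclidean_space set \<Rightarrow> ('a \<Rightarrow> real) \<Rightarrow> bool" where
  "C2_on S g \<longleftrightarrow>
     (\<forall>p\<in>S. g differentiable (at p)) \<and>
     (\<forall>w. \<forall>p\<in>S. (\<lambda>q. frechet_derivative g (at q) w) differentiable (at p)) \<and>
     (\<forall>u w. continuous_on S (\<lambda>p. hess g p u w))"

text \<open>The operator norm, from the primal norm to the dual norm, of the operator with bilinear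
  form \<open>H\<close>.\<close>

definition op_norm :: "('a::euclidean_space \<Rightarrow> 'a \<Rightarrow> real) \<Rightarrow> ('a \<Rightarrow> 'a \<Rightarrow> real) \<Rightarrow> real" where
  "op_norm B H = Sup {\<bar>H u w\<bar> | u w. bnorm B u \<le> 1 \<and> bnorm B w \<le> 1}"

definition hess_lipschitz_on ::
  "('a::euclidean_space \<Rightarrow> 'a \<Rightarrow> real) \<Rightarrow> 'a set \<Rightarrow> ('a \<Rightarrow> real) \<Rightarrow> real \<Rightarrow> bool" where
  "hess_lipschitz_on B S g l \<longleftrightarrow>
     0 \<le> l \<and>
     (\<forall>p\<in>S. \<forall>q\<in>S. op_norm B (\<lambda>u w. hess g p u w - hess g q u w) \<le> l * bnorm B (p - q))"

definition taylor2 :: "('a::euclidean_space \<Rightarrow> real ^ 'm) \<Rightarrow> 'a \<Rightarrow> 'a \<Rightarrow> real ^ 'm" where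
  "taylor2 f p q =
     (\<chi> i. let g = (\<lambda>r. f r $ i) in
        g p + frechet_derivative g (at p) (q - p) + 1/2 * hess g p (q - p) (q - p))"

section \<open>Fully composite objectives\<close>

text \<open>The inner function is a total function together with its domain \<open>D\<close>.\<close>

definition composite ::
  "('a \<Rightarrow> real ^ 'm \<Rightarrow> ereal) \<Rightarrow> ('a \<Rightarrow> real ^ 'm) \<Rightarrow> 'a set \<Rightarrow> 'a \<Rightarrow> ereal" where
  "composite F f D p = (if p \<in> D then F p (f p) else \<infinity>)"

definition composite_dom ::
  "('a \<Rightarrow> real ^ 'm \<Rightarrow> ereal) \<Rightarrow> ('a \<Rightarrow> real ^ 'm) \<Rightarrow> 'a set \<Rightarrow> 'a set" where
  "composite_dom F f D = {p \<in> D. F p (f p) < \<infinity>}"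

definition outer_const ::
  "('a \<Rightarrow> real ^ 'm \<Rightarrow> ereal) \<Rightarrow> ('a \<Rightarrow> real ^ 'm) \<Rightarrow> 'a set \<Rightarrow> real ^ 'm \<Rightarrow> ereal" where
  "outer_const F f D L = (SUP p\<in>composite_dom F f D. F p L)"

text \<open>\<open>w\<close> is produced by finitely many cubic Newton steps for the objective \<open>composite F f D\<close>,
  each minimising its model over \<open>S\<close>, from some starting point in \<open>S\<close>. The regularisation constant
  is computed in the extended reals.\<close>

definition cubic_newton_point ::
  "('a::euclidean_space \<Rightarrow> 'a \<Rightarrow> real) \<Rightarrow> ('a \<Rightarrow> real ^ 'm \<Rightarrow> ereal) \<Rightarrow> ('a \<Rightarrow> real ^ 'm) \<Rightarrow> 'a set
    \<Rightarrow> real ^ 'm \<Rightarrow> real \<Rightarrow> 'a set \<Rightarrow> 'a \<Rightarrow> bool" where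
  "cubic_newton_point B F f D L a S w \<longleftrightarrow>
     (\<exists>(z :: nat \<Rightarrow> 'a) T.
        z 0 \<in> S \<and>
        (\<forall>t<T. is_arg_min
           (\<lambda>p. F p (taylor2 f (z t) p)
                + (ereal a * outer_const F f D L) / 6 * ereal (bnorm B (p - z t) ^ 3))
           (\<lambda>p. p \<in> S) (z (Suc t))) \<and>
        w = z T)"

section \<open>The contracting proximal-point scheme\<close>

definition prox_fun :: "('a::euclidean_space \<Rightarrow> 'a \<Rightarrow> real) \<Rightarrow> real \<Rightarrow> 'a \<Rightarrow> 'a \<Rightarrow> real" where
  "prox_fun B \<alpha> x0 p = \<alpha> / 3 * bnorm B (p - x0) ^ 3"

definition bregman :: "('a::euclidean_space \<Rightarrow> real) \<Rightarrow> 'a \<Rightarrow> 'a \<Rightarrow> real" where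
  "bregman d p q = d q - d p - frechet_derivative d (at p) (q - p)"

definition A_seq :: "nat \<Rightarrow> real" where
  "A_seq k = (real k / 3) ^ 3"

definition \<gamma>_seq :: "nat \<Rightarrow> real" where
  "\<gamma>_seq k = (A_seq (Suc k) - A_seq k) / A_seq (Suc k)"

definition contract :: "nat \<Rightarrow> 'a::euclidean_space \<Rightarrow> 'a \<Rightarrow> 'a" where
  "contract k xk p = \<gamma>_seq k *\<^sub>R p + (1 - \<gamma>_seq k) *\<^sub>R xk"

text \<open>The subproblem objective $h_{k+1}$ at the state \<open>xk\<close>, \<open>vk\<close>.\<close>

definition sub_objective ::
  "('a::euclidean_space \<Rightarrow> real ^ 'm \<Rightarrow> ereal) \<Rightarrow> ('a \<Rightarrow> real ^ 'm) \<Rightarrow> 'a set \<Rightarrow> ('a \<Rightarrow> real)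
    \<Rightarrow> nat \<Rightarrow> 'a \<Rightarrow> 'a \<Rightarrow> 'a \<Rightarrow> ereal" where
  "sub_objective F f D d k xk vk p =
     ereal (A_seq (Suc k)) * composite F f D (contract k xk p) + ereal (bregman d vk p)"

text \<open>Its fully composite representation.\<close>

definition sub_outer ::
  "('a::euclidean_space \<Rightarrow> real ^ 'm \<Rightarrow> ereal) \<Rightarrow> ('a \<Rightarrow> real) \<Rightarrow> nat \<Rightarrow> 'a \<Rightarrow> 'a
    \<Rightarrow> 'a \<Rightarrow> real ^ 'm \<Rightarrow> ereal" where
  "sub_outer F d k xk vk p u =
     ereal (A_seq (Suc k)) * F (contract k xk p) u + ereal (bregman d vk p)"

definition sub_inner ::
  "('a::euclidean_space \<Rightarrow> real ^ 'm) \<Rightarrow> nat \<Rightarrow> 'a \<Rightarrow> 'a \<Rightarrow> real ^ 'm" where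
  "sub_inner f k xk p = f (contract k xk p)"

definition sub_dom :: "'a::euclidean_space set \<Rightarrow> nat \<Rightarrow> 'a \<Rightarrow> 'a set" where
  "sub_dom D k xk = {p. contract k xk p \<in> D}"

lemma composite_sub:
  "composite (sub_outer F d k xk vk) (sub_inner f k xk) (sub_dom D k xk)
     = sub_objective F f D d k xk vk"
  by (rule ext)
    (simp add: composite_def sub_outer_def sub_inner_def sub_dom_def sub_objective_def A_seq_def)

text \<open>\<open>L'\<close> ranges over the vectors of Lipschitz constants of the Hessians of the inner function
  of the subproblem.\<close>

definition contracting_prox_scheme ::
  "('a::euclidean_space \<Rightarrow> 'a \<Rightarrow> real) \<Rightarrow> ('a \<Rightarrow> real ^ 'm \<Rightarrow> ereal) \<Rightarrow> ('a \<Rightarrow> real ^ 'm) \<Rightarrow> 'a set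
    \<Rightarrow> real \<Rightarrow> real \<Rightarrow> real \<Rightarrow> (nat \<Rightarrow> 'a) \<Rightarrow> (nat \<Rightarrow> 'a) \<Rightarrow> bool" where
  "contracting_prox_scheme B F f D \<alpha> \<delta> a x v \<longleftrightarrow>
     x 0 \<in> composite_dom F f D \<and> v 0 = x 0 \<and>
     (\<forall>k. let d = prox_fun B \<alpha> (x 0);
              h = sub_objective F f D d k (x k) (v k)
          in h (v (Suc k)) - (INF p. h p) \<le> ereal \<delta> \<and>
             (\<exists>L'. (\<forall>i. hess_lipschitz_on B (sub_dom D k (x k))
                          (\<lambda>p. sub_inner f k (x k) p $ i) (L' $ i)) \<and>
                   cubic_newton_point B (sub_outer F d k (x k) (v k)) (sub_inner f k (x k))
                     (sub_dom D k (x k)) L' a (composite_dom F f D) (v (Suc k))) \<and>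
             x (Suc k) = contract k (x k) (v (Suc k)))"

definition c1 :: "('a::euclidean_space \<Rightarrow> 'a \<Rightarrow> real) \<Rightarrow> real \<Rightarrow> real \<Rightarrow> 'a \<Rightarrow> 'a \<Rightarrow> real" where
  "c1 B \<alpha> \<delta> x0 p =
     \<alpha> powr (1/3) * (6 * \<delta>) powr (2/3)
     + 2 * \<alpha> powr (2/3) * (6 * \<delta>) powr (1/3) * bnorm B (p - x0)"

definition c2 :: "real \<Rightarrow> real \<Rightarrow> real" where
  "c2 \<alpha> \<delta> = 2 * \<alpha> powr (2/3) * (6 * \<delta>) powr (1/3)"

definition C_err :: "('a::euclidean_space \<Rightarrow> 'a \<Rightarrow> real) \<Rightarrow> real \<Rightarrow> real \<Rightarrow> 'a \<Rightarrow> (nat \<Rightarrow> 'a)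
    \<Rightarrow> nat \<Rightarrow> 'a \<Rightarrow> real" where
  "C_err B \<alpha> \<delta> x0 v k p =
     real k * \<delta>
     + c1 B \<alpha> \<delta> x0 p * (\<Sum>i=1..k. bnorm B (p - v i))
     + c2 \<alpha> \<delta> * (\<Sum>i=1..k. (bnorm B (p - v i))\<^sup>2)"

end

theory Submission
  imports Defs
begin

text \<open>
  Let \<open>d\<close> be the prox-function and \<open>h\<close> the objective of the subproblem of step \<open>k\<close>, that is
  \<open>g + bregman d (v k)\<close> with \<open>g\<close> convex. If \<open>v (Suc k)\<close> minimised \<open>h\<close> exactly,
  first-order optimality would give \<open>h (v (Suc k)) + bregman d (v (Suc k)) y \<le> h y\<close> for all \<open>y\<close>.
  Convexity of the objective \<open>\<phi>\<close> bounds \<open>g y\<close> by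
  \<open>(A_seq (Suc k) - A_seq k) * \<phi> y + A_seq k * \<phi> (x k)\<close> (lemma \<open>contract_value_le\<close>), while \<open>g (v (Suc k))\<close>
  is \<open>A_seq (Suc k) * \<phi> (x (Suc k))\<close>. These inequalities telescope to the claim without error term.

  In general, for \<open>\<alpha> > 0\<close>, there is some centre \<open>z\<close> for which the infimum of \<open>h\<close> plus \<open>bregman d z y\<close>
  is at most \<open>h y\<close> (\<open>limiting_prox_point\<close>). Taking for \<open>y\<close> the inexact solution \<open>v (Suc k)\<close> gives
  \<open>bregman d z (v (Suc k)) \<le> \<delta>\<close>. Since the cubed norm is uniformly convex
  (\<open>bregman_prox_fun_ge\<close>), \<open>v (Suc k)\<close> is within distance \<open>(6 * \<delta> / \<alpha>) powr (1/3)\<close> of \<open>z\<close>. Replacing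
  the centre \<open>z\<close> by \<open>v (Suc k)\<close> costs the difference of the gradients of \<open>d\<close> at these two points,
  paired with \<open>y - v (Suc k)\<close> (\<open>bregman_prox_fun_recenter\<close>). This cost plus \<open>\<delta>\<close> is the increment of
  \<open>C_err\<close>.

  Subhomogeneity of \<open>F\<close> makes \<open>\<alpha>\<close> nonnegative (\<open>outer_const_nonneg\<close>) and so \<open>d\<close> convex.
\<close>

section \<open>The geometry of a positive definite form\<close>

locale pos_def_form =
  fixes B :: "'a::euclidean_space \<Rightarrow> 'a \<Rightarrow> real"
  assumes pos_def: "self_adjoint_pos_def B"
begin

sublocale form: bounded_bilinear B
  using pos_def by (simp add: self_adjoint_pos_def_def bilinear_conv_bounded_bilinear)

lemma form_commute: "B p q = B q p"
  using pos_def by (simp add: self_adjoint_pos_def_def)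

lemma form_nonneg: "0 \<le> B p p"
  using pos_def by (cases "p = 0") (auto simp: self_adjoint_pos_def_def form.zero_left intro: less_imp_le)

lemma bnorm_nonneg: "0 \<le> bnorm B p"
  by (simp add: bnorm_def form_nonneg)

lemma bnorm_power2: "(bnorm B p)\<^sup>2 = B p p"
  by (simp add: bnorm_def form_nonneg)

lemma bnorm_pos: "p \<noteq> 0 \<Longrightarrow> 0 < bnorm B p"
  using pos_def by (simp add: bnorm_def self_adjoint_pos_def_def)

lemma bnorm_minus_commute: "bnorm B (p - q) = bnorm B (q - p)"
  by (simp add: bnorm_def form.diff_left form.diff_right)

lemma bnorm_scaleR: "bnorm B (t *\<^sub>R p) = \<bar>t\<bar> * bnorm B p"
  by (simp add: bnorm_def form.scaleR_left form.scaleR_right real_sqrt_mult flip: mult.assoc)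

lemma bnorm_cauchy_schwarz: "\<bar>B p q\<bar> \<le> bnorm B p * bnorm B q"
proof (cases "q = 0")
  case True
  then show ?thesis by (simp add: form.zero_right bnorm_nonneg)
next
  case False
  have q: "0 < B q q" using False pos_def by (simp add: self_adjoint_pos_def_def)
  have "0 \<le> B (B q q *\<^sub>R p - B p q *\<^sub>R q) (B q q *\<^sub>R p - B p q *\<^sub>R q)"
    by (rule form_nonneg)
  also have "\<dots> = B q q * (B p p * B q q - (B p q)\<^sup>2)"
    by (simp add: form.diff_left form.diff_right form.scaleR_left form.scaleR_right
        form_commute[of q p] algebra_simps power2_eq_square)
  finally have "(B p q)\<^sup>2 \<le> B p p * B q q" using q by (simp add: zero_le_mult_iff)
  also have "\<dots> = (bnorm B p * bnorm B q)\<^sup>2" by (simp add: power_mult_distrib bnorm_power2)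
  finally show ?thesis by (simp add: abs_le_square_iff[symmetric] bnorm_nonneg)
qed

lemma bnorm_diff_power2: "(bnorm B (p - q))\<^sup>2 = (bnorm B p)\<^sup>2 + (bnorm B q)\<^sup>2 - 2 * B p q"
  by (simp add: bnorm_power2 form.diff_left form.diff_right form_commute[of q p])

lemma bnorm_triangle: "bnorm B (p + q) \<le> bnorm B p + bnorm B q"
proof (rule power2_le_imp_le)
  have "(bnorm B (p + q))\<^sup>2 = (bnorm B p)\<^sup>2 + (bnorm B q)\<^sup>2 + 2 * B p q"
    by (simp add: bnorm_power2 form.add_left form.add_right form_commute[of q p])
  also have "\<dots> \<le> (bnorm B p + bnorm B q)\<^sup>2"
    using bnorm_cauchy_schwarz[of p q] by (simp add: power2_sum)
  finally show "(bnorm B (p + q))\<^sup>2 \<le> (bnorm B p + bnorm B q)\<^sup>2" .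
qed (simp add: bnorm_nonneg)

lemma bnorm_triangle_diff: "\<bar>bnorm B p - bnorm B q\<bar> \<le> bnorm B (p - q)"
  using bnorm_triangle[of "p - q" q] bnorm_triangle[of "q - p" p] bnorm_minus_commute[of p q]
  by simp

lemma continuous_on_bnorm: "continuous_on S (bnorm B)"
  unfolding bnorm_def by (intro continuous_intros form.continuous_on)

text \<open>Balls of the form are bounded in the ambient norm, because \<open>bnorm B\<close> attains a positive minimum
  on the compact unit sphere. This lets minimising sequences be controlled by the divergence.\<close>

lemma bounded_bnorm_ball: "bounded {p. bnorm B (p - w) \<le> c}"
proof -
  have "sphere (0::'a) 1 \<noteq> {}" using SOME_Basis norm_Basis by fastforce
  then obtain e where e: "e \<in> sphere 0 1" "\<And>p. p \<in> sphere 0 1 \<Longrightarrow> bnorm B e \<le> bnorm B p"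
    using continuous_attains_inf[OF compact_sphere _ continuous_on_bnorm] by metis
  have e_pos: "0 < bnorm B e" using e(1) by (intro bnorm_pos) auto
  have lower: "bnorm B e * norm p \<le> bnorm B p" for p
  proof (cases "p = 0")
    case False
    have "bnorm B e \<le> bnorm B ((1 / norm p) *\<^sub>R p)" using False by (intro e(2)) simp
    then show ?thesis using False by (simp add: bnorm_scaleR field_simps)
  qed (simp add: bnorm_nonneg)
  show ?thesis
  proof (rule bounded_subset[OF bounded_cball])
    show "{p. bnorm B (p - w) \<le> c} \<subseteq> cball w (c / bnorm B e)"
    proof
      fix p assume "p \<in> {p. bnorm B (p - w) \<le> c}"
      then have "norm (p - w) * bnorm B e \<le> c" using lower[of "p - w"] by (simp add: mult.commute)
      then show "p \<in> cball w (c / bnorm B e)"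
        using e_pos by (simp add: dist_norm norm_minus_commute pos_le_divide_eq)
    qed
  qed
qed

section \<open>The cubic prox-function\<close>

lemma has_derivative_prox_fun:
  "(prox_fun B \<alpha> x0 has_derivative (\<lambda>u. \<alpha> * bnorm B (p - x0) * B (p - x0) u)) (at p)"
proof -
  \<comment> \<open>The cube of the norm is \<open>t \<mapsto> sqrt t * t\<close> after the form. This function, unlike \<open>sqrt\<close>, has a
    derivative at 0, so that the point \<open>x0\<close> needs no separate treatment.\<close>
  have D32: "((\<lambda>t. sqrt t * t) has_real_derivative 3 / 2 * sqrt t) (at t)" if "0 \<le> t" for t :: real
  proof (cases "t = 0")
    case True
    have "((\<lambda>h::real. sqrt h) \<longlongrightarrow> 0) (at 0)"
      using isCont_real_sqrt[of 0] by (simp add: isCont_def)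
    then have "((\<lambda>h::real. sqrt h * h / h) \<longlongrightarrow> 0) (at 0)"
      by (rule Lim_transform_eventually) (auto simp: eventually_at intro: exI[of _ 1])
    then show ?thesis using True by (simp add: has_field_derivative_iff)
  next
    case False
    then have "0 < t" using that by simp
    then have s: "t = sqrt t * sqrt t" "sqrt t \<noteq> 0" by simp_all
    have "((\<lambda>t. sqrt t * t) has_real_derivative (inverse (sqrt t) / 2) * t + 1 * sqrt t) (at t)"
      using \<open>0 < t\<close> by (intro DERIV_mult DERIV_real_sqrt DERIV_ident)
    moreover have "(inverse (sqrt t) / 2) * t + 1 * sqrt t = 3 / 2 * sqrt t"
      using s by (simp add: field_simps)
    ultimately show ?thesis by simp
  qed
  have "((\<lambda>q. B (q - x0) (q - x0)) has_derivative (\<lambda>u. B (p - x0) u + B u (p - x0))) (at p)"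
    by (auto intro!: derivative_eq_intros form.FDERIV)
  from has_derivative_compose[OF this D32[unfolded has_field_derivative_def]]
  have "((\<lambda>q. \<alpha> / 3 * (sqrt (B (q - x0) (q - x0)) * B (q - x0) (q - x0))) has_derivative
     (\<lambda>u. \<alpha> / 3 * (3 / 2 * sqrt (B (p - x0) (p - x0)) * (B (p - x0) u + B u (p - x0))))) (at p)"
    by (intro has_derivative_mult_right) (simp add: form_nonneg)
  moreover have "prox_fun B \<alpha> x0 = (\<lambda>q. \<alpha> / 3 * (sqrt (B (q - x0) (q - x0)) * B (q - x0) (q - x0)))"
    by (rule ext) (simp add: prox_fun_def power3_eq_cube bnorm_def form_nonneg)
  moreover have "(\<lambda>u. \<alpha> / 3 * (3 / 2 * sqrt (B (p - x0) (p - x0)) * (B (p - x0) u + B u (p - x0))))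
      = (\<lambda>u. \<alpha> * bnorm B (p - x0) * B (p - x0) u)"
  proof
    fix u
    show "\<alpha> / 3 * (3 / 2 * sqrt (B (p - x0) (p - x0)) * (B (p - x0) u + B u (p - x0)))
        = \<alpha> * bnorm B (p - x0) * B (p - x0) u"
      by (simp add: bnorm_def form_commute[of u "p - x0"])
  qed
  ultimately show ?thesis by simp
qed

lemma frechet_derivative_prox_fun:
  "frechet_derivative (prox_fun B \<alpha> x0) (at p) u = \<alpha> * bnorm B (p - x0) * B (p - x0) u"
  using frechet_derivative_at[OF has_derivative_prox_fun] by metis

text \<open>After expanding the form in terms of the lengths \<open>s\<close>, \<open>t\<close>, \<open>w\<close> of the sides of a triangle,
  uniform convexity of the cubed norm becomes this polynomial inequality. For \<open>w \<le> 2 * s\<close> the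
  expression increases with \<open>w\<close>, otherwise it increases with \<open>t\<close>; in both cases the extreme
  position is a degenerate triangle, where the sign can be read off.\<close>

lemma cubic_triangle_inequality:
  fixes s t w :: real
  assumes "0 \<le> s" "0 \<le> t" "\<bar>s - t\<bar> \<le> w" "w \<le> s + t"
  shows "0 \<le> 2 * t ^ 3 + s ^ 3 - 3 * s * t\<^sup>2 + 3 * s * w\<^sup>2 - w ^ 3"
proof (cases "w \<le> 2 * s")
  case True
  define e where "e = \<bar>s - t\<bar>"
  have e: "0 \<le> e" "e \<le> w" using assms by (simp_all add: e_def)
  have "3 * s * w\<^sup>2 - w ^ 3 - (3 * s * e\<^sup>2 - e ^ 3)
      = (w - e) * ((3 * s - 3 / 2 * w) * (w + e) + (w - e) * (w / 2 + e))"
    by (simp add: field_simps power2_eq_square power3_eq_cube)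
  moreover have "0 \<le> \<dots>" using e True by (intro mult_nonneg_nonneg add_nonneg_nonneg) auto
  ultimately have "3 * s * e\<^sup>2 - e ^ 3 \<le> 3 * s * w\<^sup>2 - w ^ 3" by linarith
  moreover have "0 \<le> 2 * t ^ 3 + s ^ 3 - 3 * s * t\<^sup>2 + 3 * s * e\<^sup>2 - e ^ 3"
  proof (cases "s \<le> t")
    case True
    then have "2 * t ^ 3 + s ^ 3 - 3 * s * t\<^sup>2 + 3 * s * e\<^sup>2 - e ^ 3 = (t - s)\<^sup>2 * (t + 5 * s)"
      by (simp add: e_def algebra_simps power2_eq_square power3_eq_cube)
    then show ?thesis using assms by simp
  next
    case False
    then have "2 * t ^ 3 + s ^ 3 - 3 * s * t\<^sup>2 + 3 * s * e\<^sup>2 - e ^ 3 = 3 * (s + t) * (s - t)\<^sup>2"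
      by (simp add: e_def algebra_simps power2_eq_square power3_eq_cube)
    then show ?thesis using assms by simp
  qed
  ultimately show ?thesis by linarith
next
  case False
  define u where "u = w - s"
  have u: "s \<le> u" "u \<le> t" "w = s + u" using assms False by (simp_all add: u_def)
  have "2 * t ^ 3 - 3 * s * t\<^sup>2 - (2 * u ^ 3 - 3 * s * u\<^sup>2)
      = (t - u) * (3 * (u - s) * (t + u) + (2 * t + u) * (t - u))"
    by (simp add: algebra_simps power2_eq_square power3_eq_cube)
  moreover have "0 \<le> \<dots>" using u assms by (intro mult_nonneg_nonneg add_nonneg_nonneg) auto
  moreover have "2 * u ^ 3 + s ^ 3 - 3 * s * u\<^sup>2 + 3 * s * w\<^sup>2 - w ^ 3 = (u - s) ^ 3 + 4 * s ^ 3"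
    by (simp add: u(3) algebra_simps power2_eq_square power3_eq_cube)
  moreover have "0 \<le> (u - s) ^ 3 + 4 * s ^ 3" using u assms by simp
  ultimately show ?thesis by linarith
qed

lemma bregman_prox_fun_ge:
  assumes "0 \<le> \<alpha>"
  shows "\<alpha> / 6 * bnorm B (q - p) ^ 3 \<le> bregman (prox_fun B \<alpha> x0) p q"
proof -
  define s t w where stw: "s = bnorm B (p - x0)" "t = bnorm B (q - x0)" "w = bnorm B (q - p)"
  have w2: "w\<^sup>2 = t\<^sup>2 + s\<^sup>2 - 2 * B (p - x0) (q - x0)"
    using bnorm_diff_power2[of "q - x0" "p - x0"] by (simp add: stw form_commute[of "q - x0" "p - x0"])
  have lin: "B (p - x0) (q - p) = B (p - x0) (q - x0) - s\<^sup>2"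
    using form.diff_right[of "p - x0" "q - x0" "p - x0"] by (simp add: stw bnorm_power2)
  have ip: "B (p - x0) (q - p) = (t\<^sup>2 - s\<^sup>2 - w\<^sup>2) / 2"
    using w2 lin by simp
  have "w \<le> s + t"
    using bnorm_triangle[of "q - x0" "x0 - p"] bnorm_minus_commute[of x0 p] by (simp add: stw)
  moreover have "\<bar>s - t\<bar> \<le> w"
    using bnorm_triangle_diff[of "q - x0" "p - x0"] by (simp add: stw)
  ultimately have "0 \<le> \<alpha> / 6 * (2 * t ^ 3 + s ^ 3 - 3 * s * t\<^sup>2 + 3 * s * w\<^sup>2 - w ^ 3)"
    using cubic_triangle_inequality[of s t w] assms
    by (intro mult_nonneg_nonneg) (auto simp: stw bnorm_nonneg)
  also have "\<dots> = bregman (prox_fun B \<alpha> x0) p q - \<alpha> / 6 * w ^ 3"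
    by (simp add: bregman_def frechet_derivative_prox_fun ip prox_fun_def flip: stw)
      (simp add: algebra_simps power2_eq_square power3_eq_cube add_divide_distrib diff_divide_distrib)
  finally show ?thesis by (simp add: stw)
qed

lemma bregman_prox_fun_nonneg: "0 \<le> \<alpha> \<Longrightarrow> 0 \<le> bregman (prox_fun B \<alpha> x0) p q"
  by (rule order_trans[OF _ bregman_prox_fun_ge]) (simp_all add: bnorm_nonneg)

text \<open>Moving the centre of the divergence from \<open>z\<close> to \<open>v\<close> changes it by a gradient difference,
  up to the term \<open>bregman d z v\<close>, which has the favourable sign. The gradient of the prox-function
  is Lipschitz on balls around \<open>x0\<close>, with a constant proportional to the radius; the radius is
  expressed through \<open>y\<close> to make the bound free of \<open>z\<close> apart from the distance \<open>r\<close>.\<close>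

lemma bregman_prox_fun_recenter:
  assumes "0 \<le> \<alpha>" "bnorm B (v - z) \<le> r"
  shows "bregman (prox_fun B \<alpha> x0) v y - bregman (prox_fun B \<alpha> x0) z y
    \<le> (\<alpha> * r\<^sup>2 + 2 * (\<alpha> * r) * bnorm B (y - x0)) * bnorm B (y - v)
       + 2 * (\<alpha> * r) * (bnorm B (y - v))\<^sup>2"
proof -
  define s t n where st: "s = bnorm B (z - x0)" "t = bnorm B (v - x0)" "n = bnorm B (y - v)"
  have nn: "0 \<le> s" "0 \<le> t" "0 \<le> n" "0 \<le> r"
    using assms(2) bnorm_nonneg order_trans by (auto simp: st)
  have t_le: "t \<le> bnorm B (y - x0) + n"
    using bnorm_triangle[of "v - y" "y - x0"] bnorm_minus_commute[of v y] by (simp add: st)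
  have d_st: "\<bar>s - t\<bar> \<le> bnorm B (v - z)"
    using bnorm_triangle_diff[of "v - x0" "z - x0"] by (simp add: st)
  have d_zv: "\<bar>B (z - v) (y - v)\<bar> \<le> r * n"
    using bnorm_cauchy_schwarz[of "z - v" "y - v"] assms(2) nn mult_right_mono[of "bnorm B (v - z)" r n]
    by (simp add: st bnorm_minus_commute[of z v])
  have d_v: "\<bar>B (v - x0) (y - v)\<bar> \<le> t * n"
    using bnorm_cauchy_schwarz[of "v - x0" "y - v"] by (simp add: st)
  have "0 \<le> bregman (prox_fun B \<alpha> x0) z v"
    by (rule bregman_prox_fun_nonneg[OF assms(1)])
  moreover have "B (z - x0) (y - z) = B (z - x0) (y - v) + B (z - x0) (v - z)"
    by (simp add: form.diff_right)
  moreover have "B (z - x0) (y - v) = B (z - v) (y - v) + B (v - x0) (y - v)"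
    by (simp add: form.diff_left)
  ultimately have "bregman (prox_fun B \<alpha> x0) v y - bregman (prox_fun B \<alpha> x0) z y
      \<le> \<alpha> * (s * B (z - v) (y - v) + (s - t) * B (v - x0) (y - v))"
    by (simp add: bregman_def frechet_derivative_prox_fun algebra_simps flip: st)
  also have "\<dots> \<le> \<alpha> * (s * (r * n) + r * (t * n))"
  proof (intro mult_left_mono add_mono assms(1))
    show "B (z - v) (y - v) \<le> r * n" using d_zv by simp
    have "(s - t) * B (v - x0) (y - v) \<le> \<bar>s - t\<bar> * \<bar>B (v - x0) (y - v)\<bar>"
      by (metis abs_ge_self abs_mult)
    also have "\<dots> \<le> r * (t * n)" using d_st d_v assms(2) nn by (intro mult_mono) auto
    finally show "(s - t) * B (v - x0) (y - v) \<le> r * (t * n)" .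
  qed (rule nn)
  also have "\<dots> = \<alpha> * r * n * (s + t)" by (simp add: algebra_simps)
  also have "\<dots> \<le> \<alpha> * r * n * (r + 2 * (bnorm B (y - x0) + n))"
    using d_st t_le assms nn by (intro mult_left_mono) auto
  also have "\<dots> = (\<alpha> * r\<^sup>2 + 2 * (\<alpha> * r) * bnorm B (y - x0)) * n + 2 * (\<alpha> * r) * n\<^sup>2"
    by (simp add: algebra_simps power2_eq_square)
  finally show ?thesis by (simp add: st)
qed

end

section \<open>Inexact proximal steps\<close>

text \<open>A minimiser \<open>z\<close> of \<open>g + bregman d w\<close> over \<open>S\<close> would satisfy this inequality by first-order
  optimality. A minimiser need not exist when \<open>S\<close> or the epigraph of \<open>g\<close> is not closed, but a
  limit point \<open>z\<close> of a minimising sequence will do: by continuity of the divergence the values of \<open>g\<close>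
  along a subsequence converge to the infimum minus \<open>bregman d w z\<close>, and this number can stand in
  for \<open>g z\<close> in the convexity inequality on the segment from \<open>z\<close> to \<open>y\<close>.\<close>

lemma limiting_prox_point:
  fixes d g :: "'a::euclidean_space \<Rightarrow> real"
  assumes diff: "\<And>p. d differentiable (at p)"
    and nonneg: "\<And>p. 0 \<le> bregman d w p"
    and coercive: "\<And>c. bounded {p. bregman d w p \<le> c}"
    and g: "convex_on S g" and S: "S \<noteq> {}" and below: "\<And>p. p \<in> S \<Longrightarrow> m \<le> g p"
  obtains z where
    "\<And>y. y \<in> S \<Longrightarrow> (INF p\<in>S. g p + bregman d w p) + bregman d z y \<le> g y + bregman d w y"
proof -
  define R where "R = bregman d w"
  define H where "H = (INF p\<in>S. g p + R p)"
  have R_deriv: "(R has_derivative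
      (\<lambda>u. frechet_derivative d (at p) u - frechet_derivative d (at w) u)) (at p)" for p
  proof -
    have d_p: "(d has_derivative frechet_derivative d (at p)) (at p)"
      using diff frechet_derivative_works by blast
    have "bounded_linear (frechet_derivative d (at w))"
      using diff frechet_derivative_works has_derivative_bounded_linear by blast
    then have "((\<lambda>q. frechet_derivative d (at w) (q - w)) has_derivative frechet_derivative d (at w)) (at p)"
      by (rule bounded_linear.has_derivative) (auto intro!: derivative_eq_intros)
    then have "((\<lambda>q. d q - d w - frechet_derivative d (at w) (q - w)) has_derivative
      (\<lambda>u. frechet_derivative d (at p) u - 0 - frechet_derivative d (at w) u)) (at p)"
      by (intro has_derivative_diff d_p has_derivative_const)
    then show ?thesis by (simp add: R_def bregman_def[abs_def])
  qed
  have R_cont: "isCont R p" for p using R_deriv has_derivative_continuous by blast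
  have "bdd_below ((\<lambda>p. g p + R p) ` S)"
    using below nonneg by (intro bdd_belowI2[where m = m]) (metis R_def add.right_neutral add_mono)
  then have H_le: "H \<le> g p + R p" if "p \<in> S" for p
    using that unfolding H_def by (rule cINF_lower)
  have "\<exists>p\<in>S. g p + R p < H + 1 / real (Suc n)" for n
    using cINF_less_iff[OF S \<open>bdd_below _\<close>, of "H + 1 / real (Suc n)"] by (simp add: H_def)
  then obtain X where X: "\<And>n. X n \<in> S" "\<And>n. g (X n) + R (X n) < H + 1 / real (Suc n)"
    by metis
  have "range X \<subseteq> {p. bregman d w p \<le> H + 1 - m}"
  proof clarsimp
    fix n
    have "1 / real (Suc n) \<le> 1" by simp
    then show "bregman d w (X n) \<le> H + 1 - m"
      using X(2)[of n] below[OF X(1), of n] unfolding R_def by linarith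
  qed
  then have "bounded (range X)" using coercive bounded_subset by blast
  then obtain z r where r: "strict_mono r" and lim: "(X \<circ> r) \<longlonglongrightarrow> z"
    using bounded_imp_convergent_subsequence by blast
  have lim_z: "(\<lambda>n. X (r n)) \<longlonglongrightarrow> z" using lim by (simp add: o_def)
  have "(\<lambda>n. g (X n) + R (X n)) \<longlonglongrightarrow> H"
  proof (rule tendsto_sandwich)
    show "\<forall>\<^sub>F n in sequentially. H \<le> g (X n) + R (X n)"
      "\<forall>\<^sub>F n in sequentially. g (X n) + R (X n) \<le> H + 1 / real (Suc n)"
      using H_le[OF X(1)] less_imp_le[OF X(2)] by (simp_all del: of_nat_Suc)
    show "(\<lambda>n. H + 1 / real (Suc n)) \<longlonglongrightarrow> H"
      using tendsto_add[OF tendsto_const LIMSEQ_Suc[OF lim_1_over_n], of H] by simp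
  qed simp
  then have lim_H: "(\<lambda>n. g (X (r n)) + R (X (r n))) \<longlonglongrightarrow> H"
    using LIMSEQ_subseq_LIMSEQ[OF _ r] by (simp add: o_def)
  have lim_g: "(\<lambda>n. g (X (r n))) \<longlonglongrightarrow> H - R z"
    using tendsto_diff[OF lim_H isCont_tendsto_compose[OF R_cont lim_z]] by simp
  have "H + bregman d z y \<le> g y + R y" if y: "y \<in> S" for y
  proof -
    have seg: "H \<le> (1 - \<theta>) * (H - R z) + \<theta> * g y + R (z + \<theta> *\<^sub>R (y - z))"
      if l: "0 < \<theta>" "\<theta> < 1" for \<theta>
    proof (rule tendsto_lowerbound)
      have lim_seg: "(\<lambda>n. X (r n) + \<theta> *\<^sub>R (y - X (r n))) \<longlonglongrightarrow> z + \<theta> *\<^sub>R (y - z)"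
        by (intro tendsto_intros lim_z)
      show "(\<lambda>n. (1 - \<theta>) * g (X (r n)) + \<theta> * g y + R (X (r n) + \<theta> *\<^sub>R (y - X (r n))))
          \<longlonglongrightarrow> (1 - \<theta>) * (H - R z) + \<theta> * g y + R (z + \<theta> *\<^sub>R (y - z))"
        by (intro tendsto_intros lim_g isCont_tendsto_compose[OF R_cont lim_seg])
      have "H \<le> (1 - \<theta>) * g p + \<theta> * g y + R (p + \<theta> *\<^sub>R (y - p))" if p: "p \<in> S" for p
      proof -
        have eq: "p + \<theta> *\<^sub>R (y - p) = (1 - \<theta>) *\<^sub>R p + \<theta> *\<^sub>R y" by (simp add: algebra_simps)
        have "(1 - \<theta>) *\<^sub>R p + \<theta> *\<^sub>R y \<in> S"
          using g p y l by (auto simp: convex_on_def convex_def)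
        then show ?thesis
          using H_le[of "(1 - \<theta>) *\<^sub>R p + \<theta> *\<^sub>R y"] convex_onD[OF g, of \<theta> p y] p y l
          unfolding eq by simp
      qed
      then show "\<forall>\<^sub>F n in sequentially.
          H \<le> (1 - \<theta>) * g (X (r n)) + \<theta> * g y + R (X (r n) + \<theta> *\<^sub>R (y - X (r n)))"
        using X(1) by simp
    qed simp
    define D where "D = frechet_derivative d (at z) (y - z) - frechet_derivative d (at w) (y - z)"
    have "((\<lambda>\<theta>. z + \<theta> *\<^sub>R (y - z)) has_derivative (\<lambda>\<theta>. \<theta> *\<^sub>R (y - z))) (at (0::real))"
      by (auto intro!: derivative_eq_intros)
    from has_derivative_compose[OF this, of R] R_deriv[of z]
    have "((\<lambda>\<theta>. R (z + \<theta> *\<^sub>R (y - z))) has_derivative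
        (\<lambda>\<theta>. frechet_derivative d (at z) (\<theta> *\<^sub>R (y - z))
           - frechet_derivative d (at w) (\<theta> *\<^sub>R (y - z)))) (at 0)"
      by simp
    moreover have "linear (frechet_derivative d (at p))" for p
      by (rule linear_frechet_derivative[OF diff])
    then have "(\<lambda>\<theta>. frechet_derivative d (at z) (\<theta> *\<^sub>R (y - z))
           - frechet_derivative d (at w) (\<theta> *\<^sub>R (y - z))) = (*) D"
      by (simp add: D_def linear_cmul fun_eq_iff right_diff_distrib mult.commute
          del: scaleR_diff_right)
    ultimately have "((\<lambda>\<theta>. R (z + \<theta> *\<^sub>R (y - z))) has_real_derivative D) (at 0)"
      by (simp add: has_field_derivative_def)
    then have "((\<lambda>\<theta>. (R (z + \<theta> *\<^sub>R (y - z)) - R z) / \<theta>) \<longlongrightarrow> D) (at_right 0)"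
      by (auto simp: has_field_derivative_iff intro: tendsto_mono[OF at_le])
    moreover have "\<forall>\<^sub>F \<theta> in at_right (0::real). H - R z - g y \<le> (R (z + \<theta> *\<^sub>R (y - z)) - R z) / \<theta>"
    proof (rule eventually_at_rightI[of 0 1])
      fix \<theta> :: real assume \<theta>: "\<theta> \<in> {0<..<1}"
      have "(H - R z - g y) * \<theta> \<le> R (z + \<theta> *\<^sub>R (y - z)) - R z"
        using seg[of \<theta>] \<theta> by (simp add: algebra_simps)
      then show "H - R z - g y \<le> (R (z + \<theta> *\<^sub>R (y - z)) - R z) / \<theta>"
        using \<theta> by (subst pos_le_divide_eq) auto
    qed simp
    ultimately have "H - R z - g y \<le> D" by (rule tendsto_lowerbound) simp
    moreover have "R y = R z + D + bregman d z y"
    proof -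
      have "linear (frechet_derivative d (at w))" by (rule linear_frechet_derivative[OF diff])
      then show ?thesis by (simp add: R_def D_def bregman_def linear_diff)
    qed
    ultimately show ?thesis by linarith
  qed
  then show ?thesis using that unfolding H_def R_def by blast
qed

context pos_def_form
begin

text \<open>Let \<open>\<alpha> > 0\<close>. With \<open>z\<close> the limiting exact solution, the candidate \<open>v\<close> itself obeys
  \<open>bregman d z v \<le> \<delta>\<close>, so uniform convexity puts it at distance at most
  \<open>r = (6 * \<delta> / \<alpha>) powr (1/3)\<close> from \<open>z\<close>. The coefficients \<open>c1\<close> and \<open>c2\<close> are those produced by
  replacing the centre \<open>z\<close> by \<open>v\<close> at this distance.\<close>

lemma inexact_prox_inequality:
  assumes \<alpha>: "0 \<le> \<alpha>" and \<delta>: "0 < \<delta>"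
    and g: "convex_on S g" and below: "\<And>p. p \<in> S \<Longrightarrow> m \<le> g p"
    and v: "v \<in> S"
    and inexact: "\<And>p. p \<in> S \<Longrightarrow> g v + bregman (prox_fun B \<alpha> x0) w v
                       \<le> g p + bregman (prox_fun B \<alpha> x0) w p + \<delta>"
    and y: "y \<in> S"
  shows "g v + bregman (prox_fun B \<alpha> x0) w v + bregman (prox_fun B \<alpha> x0) v y
    \<le> g y + bregman (prox_fun B \<alpha> x0) w y
       + (\<delta> + c1 B \<alpha> \<delta> x0 y * bnorm B (y - v) + c2 \<alpha> \<delta> * (bnorm B (y - v))\<^sup>2)"
proof (cases "\<alpha> = 0")
  case True
  \<comment> \<open>The divergence vanishes, and so do \<open>c1\<close> and \<open>c2\<close> because \<open>0 powr _ = 0\<close>.\<close>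
  have "bregman (prox_fun B 0 x0) p q = 0" for p q
    by (simp add: bregman_def frechet_derivative_prox_fun) (simp add: prox_fun_def)
  then show ?thesis using inexact[OF y] True by (simp add: c1_def c2_def)
next
  case False
  then have \<alpha>_pos: "0 < \<alpha>" using \<alpha> by simp
  let ?d = "prox_fun B \<alpha> x0"
  define r where "r = (6 * \<delta> / \<alpha>) powr (1/3)"
  have cube_le: "bnorm B (q - p) ^ 3 \<le> 6 * c / \<alpha>" if "bregman ?d p q \<le> c" for p q c
    using bregman_prox_fun_ge[OF \<alpha>, of q p x0] that \<alpha>_pos by (simp add: field_simps)
  have r_pos: "0 \<le> r" by (simp add: r_def)
  have r3: "r ^ 3 = 6 * \<delta> / \<alpha>"
    using \<alpha>_pos \<delta> by (simp add: r_def powr_powr flip: powr_realpow)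
  have nonneg: "0 \<le> bregman ?d w p" for p
    by (rule bregman_prox_fun_nonneg[OF \<alpha>])
  have coercive: "bounded {p. bregman ?d w p \<le> c}" for c
  proof (rule bounded_subset[OF bounded_bnorm_ball])
    show "{p. bregman ?d w p \<le> c} \<subseteq> {p. bnorm B (p - w) \<le> root 3 (6 * c / \<alpha>)}"
    proof clarsimp
      fix p assume "bregman ?d w p \<le> c"
      then have "root 3 (bnorm B (p - w) ^ 3) \<le> root 3 (6 * c / \<alpha>)"
        using cube_le real_root_le_mono[of 3] by simp
      then show "bnorm B (p - w) \<le> root 3 (6 * c / \<alpha>)"
        by (simp add: real_root_power_cancel bnorm_nonneg)
    qed
  qed
  have "S \<noteq> {}" using v by auto
  with limiting_prox_point[of ?d w S g m] has_derivative_prox_fun nonneg coercive g below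
  obtain z where z: "\<And>q. q \<in> S \<Longrightarrow>
      (INF p\<in>S. g p + bregman ?d w p) + bregman ?d z q \<le> g q + bregman ?d w q"
    unfolding differentiable_def by blast
  have H: "g v + bregman ?d w v - \<delta> \<le> (INF p\<in>S. g p + bregman ?d w p)"
    using \<open>S \<noteq> {}\<close> inexact by (intro cINF_greatest) (auto simp: algebra_simps)
  have "bregman ?d z v \<le> \<delta>" using z[OF v] H by linarith
  then have "bnorm B (v - z) ^ 3 \<le> r ^ 3" using cube_le r3 by simp
  then have dist: "bnorm B (v - z) \<le> r" using r_pos power_le_imp_le_base[of _ 2 r]
    by (simp add: numeral_3_eq_3 numeral_2_eq_2)
  have "\<alpha> powr (2/3) = \<alpha> powr (1 - 1/3)" "\<alpha> powr (1/3) = \<alpha> powr (1 - 2/3)" by simp_all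
  then have split: "\<alpha> powr (2/3) = \<alpha> / \<alpha> powr (1/3)" "\<alpha> powr (1/3) = \<alpha> / \<alpha> powr (2/3)"
    using \<alpha>_pos powr_diff[of \<alpha> 1 "1/3"] powr_diff[of \<alpha> 1 "2/3"] by simp_all
  have ar: "\<alpha> powr (2/3) * (6 * \<delta>) powr (1/3) = \<alpha> * r"
    using \<alpha>_pos \<delta> unfolding split(1) r_def by (simp add: powr_divide)
  have "r\<^sup>2 = (6 * \<delta> / \<alpha>) powr (2/3)"
    using \<alpha>_pos \<delta> by (simp add: r_def powr_powr flip: powr_realpow)
  then have ar2: "\<alpha> powr (1/3) * (6 * \<delta>) powr (2/3) = \<alpha> * r\<^sup>2"
    using \<alpha>_pos \<delta> unfolding split(2) by (simp add: powr_divide)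
  have "bregman ?d v y - bregman ?d z y
      \<le> c1 B \<alpha> \<delta> x0 y * bnorm B (y - v) + c2 \<alpha> \<delta> * (bnorm B (y - v))\<^sup>2"
    using bregman_prox_fun_recenter[OF \<alpha> dist, of x0 y]
    by (simp add: c1_def c2_def ar2 mult.assoc ar)
  then show ?thesis using z[OF y] H by linarith
qed

end

section \<open>Convexity of the composite objective\<close>

lemma composite_eq_ereal:
  assumes "\<And>p u. F p u \<noteq> -\<infinity>" "p \<in> composite_dom F f D"
  shows "composite F f D p = ereal (real_of_ereal (composite F f D p))"
  using assms by (cases "F p (f p)") (auto simp: composite_def composite_dom_def)

lemma composite_outside_dom: "p \<notin> composite_dom F f D \<Longrightarrow> composite F f D p = \<infinity>"
  by (auto simp: composite_def composite_dom_def)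

text \<open>The components of \<open>f\<close> are convex, \<open>F\<close> is jointly convex and increasing in its second argument.
  The joint effective domain is convex as a projection of the epigraph; this supplies the nonempty
  slice at a convex combination on which monotonicity acts.\<close>

lemma convex_on_composite:
  fixes f :: "'a::euclidean_space \<Rightarrow> real ^ 'm"
  assumes proper: "\<And>p u. F p u \<noteq> -\<infinity>"
    and F: "closed_convex_on {(p, u). F p u < \<infinity>} (\<lambda>(p, u). F p u)"
    and mono: "\<And>p u w. {u. F p u < \<infinity>} \<noteq> {} \<Longrightarrow> u \<le> w \<Longrightarrow> F p u \<le> F p w"
    and D: "convex D"
    and f: "\<And>i. closed_convex_on D (\<lambda>p. ereal (f p $ i))"
  shows "convex_on (composite_dom F f D) (\<lambda>p. real_of_ereal (composite F f D p))"
proof -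
  define \<phi> where "\<phi> p = real_of_ereal (composite F f D p)" for p
  have conv: "s *\<^sub>R p + t *\<^sub>R q \<in> composite_dom F f D \<and> \<phi> (s *\<^sub>R p + t *\<^sub>R q) \<le> s * \<phi> p + t * \<phi> q"
    if pq: "p \<in> composite_dom F f D" "q \<in> composite_dom F f D"
      and st: "0 \<le> s" "0 \<le> t" "s + t = 1" for p q s t
  proof -
    let ?r = "s *\<^sub>R p + t *\<^sub>R q"
    let ?u = "s *\<^sub>R f p + t *\<^sub>R f q"
    have pqD: "p \<in> D" "q \<in> D" using pq by (auto simp: composite_dom_def)
    then have rD: "?r \<in> D" using D st by (simp add: convex_def)
    have val: "F p (f p) = ereal (\<phi> p)" if "p \<in> composite_dom F f D" for p
      using composite_eq_ereal[where F = F, OF proper that] that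
      by (simp add: \<phi>_def composite_def composite_dom_def)
    have "f ?r $ i \<le> ?u $ i" for i
    proof -
      have "convex (epigraph_on D (\<lambda>p. ereal (f p $ i)))"
        using f by (simp add: closed_convex_on_def)
      moreover have "(p, f p $ i) \<in> epigraph_on D (\<lambda>p. ereal (f p $ i))"
        "(q, f q $ i) \<in> epigraph_on D (\<lambda>p. ereal (f p $ i))"
        using pqD by (auto simp: epigraph_on_def)
      ultimately have "s *\<^sub>R (p, f p $ i) + t *\<^sub>R (q, f q $ i)
          \<in> epigraph_on D (\<lambda>p. ereal (f p $ i))"
        using st by (intro convexD)
      then show ?thesis by (simp add: epigraph_on_def)
    qed
    then have f_le: "f ?r \<le> ?u" by (simp add: less_eq_vec_def)
    let ?E = "epigraph_on {(p, u). F p u < \<infinity>} (\<lambda>(p, u). F p u)"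
    have "convex ?E" using F by (simp add: closed_convex_on_def)
    moreover have "((p, f p), \<phi> p) \<in> ?E" "((q, f q), \<phi> q) \<in> ?E"
      using pq val by (auto simp: epigraph_on_def)
    ultimately have "s *\<^sub>R ((p, f p), \<phi> p) + t *\<^sub>R ((q, f q), \<phi> q) \<in> ?E"
      using st by (intro convexD)
    then have u: "F ?r ?u < \<infinity>" "F ?r ?u \<le> ereal (s * \<phi> p + t * \<phi> q)"
      by (auto simp: epigraph_on_def)
    have "{u. F ?r u < \<infinity>} \<noteq> {}" using u(1) by blast
    then have "F ?r (f ?r) \<le> F ?r ?u" using mono f_le by blast
    then have le: "F ?r (f ?r) < \<infinity>" "F ?r (f ?r) \<le> ereal (s * \<phi> p + t * \<phi> q)"
      using u by auto
    have "?r \<in> composite_dom F f D" using rD le(1) by (simp add: composite_dom_def)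
    then show ?thesis using val[of ?r] le(2) by simp
  qed
  have "convex (composite_dom F f D)" using conv by (auto simp: convex_def)
  moreover have "\<phi> (s *\<^sub>R p + t *\<^sub>R q) \<le> s * \<phi> p + t * \<phi> q"
    if "p \<in> composite_dom F f D" "q \<in> composite_dom F f D" "0 \<le> s" "0 \<le> t" "s + t = 1" for p q s t
    using conv that by blast
  ultimately have "convex_on (composite_dom F f D) \<phi>" by (simp add: convex_on_def)
  then show ?thesis by (simp add: \<phi>_def[abs_def])
qed

text \<open>Subhomogeneity makes \<open>F p L\<close> nonnegative: adding \<open>L \<ge> 0\<close> to the second argument can
  only increase \<open>F\<close>, and increases it by at most \<open>F p L\<close>.\<close>

lemma outer_const_nonneg:
  fixes f :: "'a::euclidean_space \<Rightarrow> real ^ 'm"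
  assumes proper: "\<And>p u. F p u \<noteq> -\<infinity>"
    and mono: "\<And>p u w. {u. F p u < \<infinity>} \<noteq> {} \<Longrightarrow> u \<le> w \<Longrightarrow> F p u \<le> F p w"
    and subhom: "\<And>p u w t. p \<in> composite_dom F f D \<Longrightarrow> 0 \<le> t \<Longrightarrow>
         F p (u + t *\<^sub>R w) \<le> F p u + ereal t * F p w"
    and L: "0 \<le> L" and p: "p \<in> composite_dom F f D"
  shows "0 \<le> outer_const F f D L"
proof -
  have fin: "F p (f p) < \<infinity>" using p by (simp add: composite_dom_def)
  have "F p (f p) \<le> F p (f p + L)" using fin L by (intro mono) auto
  also have "\<dots> \<le> F p (f p) + F p L" using subhom[OF p, of 1 "f p" L] by simp
  finally have "0 \<le> F p L" using fin proper[of p "f p"]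
    by (cases "F p (f p)"; cases "F p L") auto
  also have "\<dots> \<le> outer_const F f D L" unfolding outer_const_def using p by (rule SUP_upper)
  finally show ?thesis .
qed

section \<open>The contracting scheme\<close>

lemma A_seq_pos: "0 < A_seq (Suc k)"
  by (simp add: A_seq_def)

lemma A_seq_mono: "A_seq k \<le> A_seq (Suc k)"
  by (simp add: A_seq_def power_mono divide_right_mono)

lemma A_seq_mult_\<gamma>_seq: "A_seq (Suc k) * \<gamma>_seq k = A_seq (Suc k) - A_seq k"
  using A_seq_pos[of k] by (simp add: \<gamma>_seq_def)

lemma \<gamma>_seq_bounds: "0 \<le> \<gamma>_seq k" "\<gamma>_seq k \<le> 1"
proof -
  have "0 \<le> A_seq k" by (simp add: A_seq_def)
  then show "0 \<le> \<gamma>_seq k" "\<gamma>_seq k \<le> 1"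
    using A_seq_pos[of k] A_seq_mono[of k] by (simp_all add: \<gamma>_seq_def)
qed

lemma contract_self: "contract k p p = p"
  by (simp add: contract_def flip: scaleR_left_distrib)

lemma contract_mem: "convex S \<Longrightarrow> p \<in> S \<Longrightarrow> q \<in> S \<Longrightarrow> contract k p q \<in> S"
  using \<gamma>_seq_bounds[of k] by (simp add: contract_def convex_def)

lemma convex_on_contract:
  assumes "convex_on S \<phi>"
  shows "convex_on {p. contract k xk p \<in> S} (\<lambda>p. A_seq (Suc k) * \<phi> (contract k xk p))"
proof -
  have mix: "contract k xk (s *\<^sub>R p + t *\<^sub>R q) = s *\<^sub>R contract k xk p + t *\<^sub>R contract k xk q"
    if "s + t = 1" for s t p q
  proof -
    have t: "t = 1 - s" using that by simp
    show ?thesis unfolding t by (simp add: contract_def algebra_simps)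
  qed
  have S: "convex S" using assms by (simp add: convex_on_def)
  have "convex {p. contract k xk p \<in> S}"
    using S by (auto simp: convex_def mix)
  moreover have "A_seq (Suc k) * \<phi> (contract k xk (s *\<^sub>R p + t *\<^sub>R q))
      \<le> s * (A_seq (Suc k) * \<phi> (contract k xk p)) + t * (A_seq (Suc k) * \<phi> (contract k xk q))"
    if "contract k xk p \<in> S" "contract k xk q \<in> S" "0 \<le> s" "0 \<le> t" "s + t = 1" for s t p q
  proof -
    have "\<phi> (contract k xk (s *\<^sub>R p + t *\<^sub>R q)) \<le> s * \<phi> (contract k xk p) + t * \<phi> (contract k xk q)"
      using assms that by (simp add: convex_on_def mix)
    from mult_left_mono[OF this less_imp_le[OF A_seq_pos[of k]]] show ?thesis
      by (simp add: algebra_simps)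
  qed
  ultimately show ?thesis by (simp add: convex_on_def)
qed

text \<open>Since \<open>\<gamma>_seq k\<close> is the fraction of \<open>A_seq (Suc k)\<close> added at step \<open>k\<close>, the previous value
  \<open>\<phi> xk\<close> keeps exactly its old weight \<open>A_seq k\<close>; this makes the inequalities of the steps telescope.\<close>

lemma contract_value_le:
  assumes "convex_on S \<phi>" "xk \<in> S" "y \<in> S"
  shows "A_seq (Suc k) * \<phi> (contract k xk y) \<le> (A_seq (Suc k) - A_seq k) * \<phi> y + A_seq k * \<phi> xk"
proof -
  have "\<phi> (contract k xk y) \<le> \<gamma>_seq k * \<phi> y + (1 - \<gamma>_seq k) * \<phi> xk"
    using assms \<gamma>_seq_bounds[of k] by (simp add: convex_on_def contract_def)
  from mult_left_mono[OF this less_imp_le[OF A_seq_pos[of k]]]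
  have "A_seq (Suc k) * \<phi> (contract k xk y)
      \<le> (A_seq (Suc k) * \<gamma>_seq k) * \<phi> y + (A_seq (Suc k) - A_seq (Suc k) * \<gamma>_seq k) * \<phi> xk"
    by (simp add: algebra_simps)
  then show ?thesis by (simp add: A_seq_mult_\<gamma>_seq)
qed

text \<open>The bound \<open>m\<close> and the point \<open>q\<close> make the infimum finite, without which the difference in the
  stopping rule would say nothing about \<open>v\<close>. In the scheme, \<open>m\<close> comes from the solution of the problem
  and \<open>q\<close> is the current iterate; membership of \<open>v\<close> in \<open>S\<close> keeps the next one in the domain.\<close>

lemma approximate_minimiser_real:
  fixes h :: "'a \<Rightarrow> ereal"
  assumes approx: "h v - (INF p. h p) \<le> ereal \<delta>"
    and h: "\<And>p. p \<in> S \<Longrightarrow> h p = ereal (g p)" and outside: "\<And>p. p \<notin> S \<Longrightarrow> h p = \<infinity>"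
    and below: "\<And>p. p \<in> S \<Longrightarrow> m \<le> g p" and q: "q \<in> S"
  shows "v \<in> S" "\<And>p. p \<in> S \<Longrightarrow> g v \<le> g p + \<delta>"
proof -
  have "ereal m \<le> h p" for p using h below outside by (cases "p \<in> S") auto
  then have lo: "ereal m \<le> (INF p. h p)" by (intro INF_greatest)
  have up: "(INF p. h p) \<le> ereal (g p)" if "p \<in> S" for p
    using INF_lower[of p UNIV h] h[OF that] by simp
  obtain H where H: "(INF p. h p) = ereal H"
    using lo up[OF q] by (cases "INF p. h p") auto
  show v: "v \<in> S" using approx outside[of v] unfolding H by (cases "v \<in> S") auto
  show "g v \<le> g p + \<delta>" if "p \<in> S" for p
    using approx up[OF that] h[OF v] unfolding H by simp
qed

lemma C_err_Suc:
  "C_err B \<alpha> \<delta> x0 v (Suc k) y = C_err B \<alpha> \<delta> x0 v k y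
     + (\<delta> + c1 B \<alpha> \<delta> x0 y * bnorm B (y - v (Suc k)) + c2 \<alpha> \<delta> * (bnorm B (y - v (Suc k)))\<^sup>2)"
  by (simp add: C_err_def algebra_simps)

theorem theorem11:
  fixes B :: "'a::euclidean_space \<Rightarrow> 'a \<Rightarrow> real"
    and F :: "'a \<Rightarrow> real ^ 'm \<Rightarrow> ereal"
    and f :: "'a \<Rightarrow> real ^ 'm"
    and D :: "'a set"
    and L :: "real ^ 'm"
    and \<alpha> \<delta> a :: real
    and x v :: "nat \<Rightarrow> 'a"
  assumes B: "self_adjoint_pos_def B"
    and F_proper: "\<And>p u. F p u \<noteq> -\<infinity>"
    and F_closed_convex: "closed_convex_on {(p, u). F p u < \<infinity>} (\<lambda>(p, u). F p u)"
    and F_slice_closed_convex: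
      "\<And>p. {u. F p u < \<infinity>} \<noteq> {} \<Longrightarrow> closed_convex_on {u. F p u < \<infinity>} (F p)"
    and F_slice_mono:
      "\<And>p u w. {u. F p u < \<infinity>} \<noteq> {} \<Longrightarrow> u \<le> w \<Longrightarrow> F p u \<le> F p w"
    and F_subhomogeneous:
      "\<And>p u w t. p \<in> composite_dom F f D \<Longrightarrow> 0 \<le> t \<Longrightarrow>
         F p (u + t *\<^sub>R w) \<le> F p u + ereal t * F p w"
    and D: "open D" "convex D"
    and f_closed_convex: "\<And>i. closed_convex_on D (\<lambda>p. ereal (f p $ i))"
    and f_C2: "\<And>i. C2_on D (\<lambda>p. f p $ i)"
    and f_hess_lipschitz: "\<And>i. hess_lipschitz_on B D (\<lambda>p. f p $ i) (L $ i)"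
    and solution: "\<exists>xs. is_arg_min (composite F f D) (\<lambda>p. p \<in> composite_dom F f D) xs"
    and \<alpha>: "ereal \<alpha> = outer_const F f D L"
    and \<delta>: "\<delta> > 0"
    and a: "a \<ge> 1"
    and scheme: "contracting_prox_scheme B F f D \<alpha> \<delta> a x v"
  shows "\<forall>k y.
    ereal (A_seq k) * composite F f D (x k) + ereal (bregman (prox_fun B \<alpha> (x 0)) (v k) y)
    \<le> ereal (A_seq k) * composite F f D y + ereal (bregman (prox_fun B \<alpha> (x 0)) (x 0) y)
       + ereal (C_err B \<alpha> \<delta> (x 0) v k y)"
  proof -
  interpret pos_def_form B by standard (rule B)
  define S where "S = composite_dom F f D"
  define \<phi> where "\<phi> p = real_of_ereal (composite F f D p)" for p
  define d where "d = prox_fun B \<alpha> (x 0)"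
  have \<phi>: "composite F f D p = ereal (\<phi> p)" if "p \<in> S" for p
    using composite_eq_ereal[where F = F, OF F_proper] that unfolding S_def \<phi>_def by blast
  have outside: "composite F f D p = \<infinity>" if "p \<notin> S" for p
    using composite_outside_dom that unfolding S_def .
  have conv: "convex_on S \<phi>"
    unfolding S_def \<phi>_def
    by (rule convex_on_composite[where F = F, OF F_proper F_closed_convex F_slice_mono D(2) f_closed_convex])
  then have S_convex: "convex S" by (simp add: convex_on_def)
  obtain xs where xs: "xs \<in> S" "\<And>p. p \<in> S \<Longrightarrow> \<phi> xs \<le> \<phi> p"
    using solution \<phi> unfolding is_arg_min_linorder S_def by auto
  have "0 \<le> L" using f_hess_lipschitz by (simp add: less_eq_vec_def hess_lipschitz_on_def)
  then have "0 \<le> outer_const F f D L"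
    by (intro outer_const_nonneg[where p = xs])
      (use xs(1) in \<open>simp_all add: S_def F_proper F_slice_mono F_subhomogeneous\<close>)
  then have \<alpha>_nonneg: "0 \<le> \<alpha>" by (simp flip: \<alpha>)
  have breg_nonneg: "0 \<le> bregman d p q" for p q
    unfolding d_def by (rule bregman_prox_fun_nonneg[OF \<alpha>_nonneg])
  have x0: "x 0 \<in> S" "v 0 = x 0"
    using scheme by (auto simp: contracting_prox_scheme_def S_def)
  have step: "sub_objective F f D d k (x k) (v k) (v (Suc k))
        - (INF p. sub_objective F f D d k (x k) (v k) p) \<le> ereal \<delta>"
    "x (Suc k) = contract k (x k) (v (Suc k))" for k
    using scheme by (auto simp: contracting_prox_scheme_def d_def Let_def)
  define T where "T k = {p. contract k (x k) p \<in> S}" for k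
  define g where "g k p = A_seq (Suc k) * \<phi> (contract k (x k) p)" for k p
  have sub_in: "sub_objective F f D d k (x k) (v k) p = ereal (g k p + bregman d (v k) p)"
    if "p \<in> T k" for k p
    using that by (simp add: sub_objective_def T_def g_def \<phi>)
  have sub_out: "sub_objective F f D d k (x k) (v k) p = \<infinity>" if "p \<notin> T k" for k p
    using that A_seq_pos[of k] by (simp add: sub_objective_def T_def outside)
  have g_below: "A_seq (Suc k) * \<phi> xs \<le> g k p" if "p \<in> T k" for k p
    using that xs(2) A_seq_pos[of k] by (simp add: T_def g_def)
  then have h_below: "A_seq (Suc k) * \<phi> xs \<le> g k p + bregman d (v k) p" if "p \<in> T k" for k p
    using that breg_nonneg[of "v k" p] by fastforce
  have approx: "v (Suc k) \<in> T k"
    "p \<in> T k \<Longrightarrow> g k (v (Suc k)) + bregman d (v k) (v (Suc k)) \<le> g k p + bregman d (v k) p + \<delta>"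
    if "x k \<in> S" for k p
  proof -
    have "x k \<in> T k" using that by (simp add: T_def contract_self)
    note * = approximate_minimiser_real[OF step(1) sub_in sub_out h_below this]
    show "v (Suc k) \<in> T k" by (rule *(1))
    show "p \<in> T k \<Longrightarrow> g k (v (Suc k)) + bregman d (v k) (v (Suc k)) \<le> g k p + bregman d (v k) p + \<delta>"
      by (rule *(2))
  qed
  have x_mem: "x k \<in> S" for k
  proof (induction k)
    case (Suc k)
    then show ?case using approx(1) step(2) by (simp add: T_def)
  qed (rule x0)
  have main: "A_seq k * \<phi> (x k) + bregman d (v k) y
      \<le> A_seq k * \<phi> y + bregman d (x 0) y + C_err B \<alpha> \<delta> (x 0) v k y" if y: "y \<in> S" for k y
  proof (induction k)
    case 0
    then show ?case by (simp add: A_seq_def x0 C_err_def)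
  next
    case (Suc k)
    have yT: "y \<in> T k" using contract_mem[OF S_convex x_mem y] by (simp add: T_def)
    have "convex_on (T k) (g k)"
      using convex_on_contract[OF conv] by (simp add: T_def g_def[abs_def])
    then have "g k (v (Suc k)) + bregman d (v k) (v (Suc k)) + bregman d (v (Suc k)) y
        \<le> g k y + bregman d (v k) y
          + (\<delta> + c1 B \<alpha> \<delta> (x 0) y * bnorm B (y - v (Suc k)) + c2 \<alpha> \<delta> * (bnorm B (y - v (Suc k)))\<^sup>2)"
      using g_below approx[OF x_mem] yT unfolding d_def
      by (intro inexact_prox_inequality[OF \<alpha>_nonneg \<delta>]) auto
    moreover have "g k (v (Suc k)) = A_seq (Suc k) * \<phi> (x (Suc k))"
      by (simp add: g_def step(2))
    moreover have "g k y \<le> (A_seq (Suc k) - A_seq k) * \<phi> y + A_seq k * \<phi> (x k)"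
      unfolding g_def by (rule contract_value_le[OF conv x_mem y])
    ultimately show ?case
      using Suc.IH breg_nonneg[of "v k" "v (Suc k)"] C_err_Suc[of B \<alpha> \<delta> "x 0" v k y]
      by (simp add: left_diff_distrib)
  qed
  show ?thesis
  proof (intro allI)
    fix k y
    show "ereal (A_seq k) * composite F f D (x k) + ereal (bregman (prox_fun B \<alpha> (x 0)) (v k) y)
      \<le> ereal (A_seq k) * composite F f D y + ereal (bregman (prox_fun B \<alpha> (x 0)) (x 0) y)
       + ereal (C_err B \<alpha> \<delta> (x 0) v k y)"
    proof (cases "y \<in> S")
      case True
      then show ?thesis using main[OF True, of k] by (simp add: \<phi> x_mem d_def)
    next
      case False
      show ?thesis
      proof (cases k)
        \<comment> \<open>For \<open>k = 0\<close> the weight is 0, and \<open>0 * \<infinity> = 0\<close>: both sides are the divergence from \<open>x 0\<close>.\<close>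
        case 0
        then show ?thesis by (simp add: A_seq_def x0 C_err_def flip: zero_ereal_def)
      next
        case (Suc n)
        then show ?thesis using False A_seq_pos[of n] by (simp add: outside)
      qed
    qed
  qed
qed

end
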